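(* Let $d\ge 1$ be an integer, let $\nu_0,\nu_1$ be probability vectors on $\{1,\dots,d\}$, let $\varepsilon>0$, and let $K^\varepsilon$ be the Gibbs kernel $K^\varepsilon_{ij}=e^{-(i-j)^2/\varepsilon}$. Let $\gamma^\varepsilon$ be the unique minimizer of the entropically regularized transport problem between $\nu_0$ and $\nu_1$, let $\gamma^{(2k+1)}$ ($k\in\mathbb N$) be the plans $\gamma^{(2k+1)}_{ij}=u^{(k+1)}_iK^\varepsilon_{ij}v^{(k)}_j$ produced by Sinkhorn's algorithm, and put $f_\varepsilon:=f_{\gamma^\varepsilon}$ and $f_{(k)}:=f_{\gamma^{(2k+1)}}$, which are functions on $\{i\in\{1,\dots,d\}:\nu_0(i)>0\}$. Then $f_{(k)}\to f_\varepsilon$ as $k\to+\infty$, and moreover $$\|f_{(k)}-f_\varepsilon\|_\infty=O\big(\lambda(K^\varepsilon)^{2k}\big)\qquad (k\to+\infty),$$ where $\|\cdot\|_\infty$ is the sup norm over $\{i:\nu_0(i)>0\}$.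
   Context: Regularized transport. $\Pi(\nu_0,\nu_1)$ is the set of $d\times d$ matrices $\gamma$ with nonnegative entries such that $\sum_j\gamma_{ij}=\nu_0(i)$ for all $i$ and $\sum_i\gamma_{ij}=\nu_1(j)$ for all $j$. With $h(\gamma)=-\sum_{i,j}\gamma_{ij}(\log\gamma_{ij}-1)$ (convention $0\log 0=0$), the regularized problem is to minimize $\sum_{i,j}(i-j)^2\gamma_{ij}-\varepsilon\, h(\gamma)$ over $\gamma\in\Pi(\nu_0,\nu_1)$. It is known to have a unique minimizer $\gamma^\varepsilon$. Sinkhorn's algorithm. Start from $u^{(0)}=v^{(0)}=(1,\dots,1)$ and set, for $k\ge 0$, $$u^{(k+1)}_i=\frac{\nu_0(i)}{\sum_jK^\varepsilon_{ij}v^{(k)}_j},\qquad v^{(k+1)}_j=\frac{\nu_1(j)}{\sum_iK^\varepsilon_{ij}u^{(k+1)}_i}.$$ Associated function. For a nonnegative matrix $\gamma$ and any $i$ with $\sum_j\gamma_{ij}>0$, $$f_\gamma(i):=\frac{\sum_j\gamma_{ij}\cdot j}{\sum_j\gamma_{ij}}-i.$$ Contraction coefficient. For a matrix $K$ with positive entries, $\eta(K):=\max_{i,j,i',j'}\frac{K_{ij}K_{i'j'}}{K_{i'j}K_{ij'}}$ and $\lambda(K):=\frac{\sqrt{\eta(K)}-1}{\sqrt{\eta(K)}+1}$. *)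

theory Defs
  imports "HOL-Analysis.Analysis" "HOL-Library.Landau_Symbols"
begin

text \<open>Vectors and matrices indexed by \<open>{1..d}\<close> are functions on \<open>nat\<close>; only their values at
  indices in \<open>{1..d}\<close> are constrained or used.\<close>

definition prob_vector :: "nat \<Rightarrow> (nat \<Rightarrow> real) \<Rightarrow> bool" where
  "prob_vector d \<nu> \<longleftrightarrow> (\<forall>i\<in>{1..d}. 0 \<le> \<nu> i) \<and> (\<Sum>i=1..d. \<nu> i) = 1"

definition vec_support :: "nat \<Rightarrow> (nat \<Rightarrow> real) \<Rightarrow> nat set" where
  "vec_support d \<nu> = {i \<in> {1..d}. 0 < \<nu> i}"

definition transport_plans ::
    "nat \<Rightarrow> (nat \<Rightarrow> real) \<Rightarrow> (nat \<Rightarrow> real) \<Rightarrow> (nat \<Rightarrow> nat \<Rightarrow> real) set" where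
  "transport_plans d \<nu>\<^sub>0 \<nu>\<^sub>1 =
    {\<gamma>. (\<forall>i\<in>{1..d}. \<forall>j\<in>{1..d}. 0 \<le> \<gamma> i j)
       \<and> (\<forall>i\<in>{1..d}. (\<Sum>j=1..d. \<gamma> i j) = \<nu>\<^sub>0 i)
       \<and> (\<forall>j\<in>{1..d}. (\<Sum>i=1..d. \<gamma> i j) = \<nu>\<^sub>1 j)}"

text \<open>The convention \<open>0 log 0 = 0\<close> holds automatically, the factor \<open>\<gamma> i j\<close> being zero.\<close>

definition plan_entropy :: "nat \<Rightarrow> (nat \<Rightarrow> nat \<Rightarrow> real) \<Rightarrow> real" where
  "plan_entropy d \<gamma> = - (\<Sum>i=1..d. \<Sum>j=1..d. \<gamma> i j * (ln (\<gamma> i j) - 1))"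

definition regularized_cost :: "nat \<Rightarrow> real \<Rightarrow> (nat \<Rightarrow> nat \<Rightarrow> real) \<Rightarrow> real" where
  "regularized_cost d \<epsilon> \<gamma> =
    (\<Sum>i=1..d. \<Sum>j=1..d. (real i - real j)^2 * \<gamma> i j) - \<epsilon> * plan_entropy d \<gamma>"

definition gibbs_kernel :: "real \<Rightarrow> nat \<Rightarrow> nat \<Rightarrow> real" where
  "gibbs_kernel \<epsilon> i j = exp (- ((real i - real j)^2) / \<epsilon>)"

fun sinkhorn_u :: "nat \<Rightarrow> (nat \<Rightarrow> nat \<Rightarrow> real) \<Rightarrow> (nat \<Rightarrow> real) \<Rightarrow> (nat \<Rightarrow> real) \<Rightarrow> nat \<Rightarrow> nat \<Rightarrow> real"
  and sinkhorn_v :: "nat \<Rightarrow> (nat \<Rightarrow> nat \<Rightarrow> real) \<Rightarrow> (nat \<Rightarrow> real) \<Rightarrow> (nat \<Rightarrow> real) \<Rightarrow> nat \<Rightarrow> nat \<Rightarrow> real"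
where
  "sinkhorn_u d K \<nu>\<^sub>0 \<nu>\<^sub>1 0 i = 1"
| "sinkhorn_u d K \<nu>\<^sub>0 \<nu>\<^sub>1 (Suc k) i =
     \<nu>\<^sub>0 i / (\<Sum>j=1..d. K i j * sinkhorn_v d K \<nu>\<^sub>0 \<nu>\<^sub>1 k j)"
| "sinkhorn_v d K \<nu>\<^sub>0 \<nu>\<^sub>1 0 j = 1"
| "sinkhorn_v d K \<nu>\<^sub>0 \<nu>\<^sub>1 (Suc k) j =
     \<nu>\<^sub>1 j / (\<Sum>i=1..d. K i j * sinkhorn_u d K \<nu>\<^sub>0 \<nu>\<^sub>1 (Suc k) i)"

text \<open>\<open>sinkhorn_plan_odd \<dots> k\<close> is the plan \<open>\<gamma>\<close> with superscript \<open>(2k+1)\<close>.\<close>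

definition sinkhorn_plan_odd ::
    "nat \<Rightarrow> (nat \<Rightarrow> nat \<Rightarrow> real) \<Rightarrow> (nat \<Rightarrow> real) \<Rightarrow> (nat \<Rightarrow> real) \<Rightarrow> nat \<Rightarrow> nat \<Rightarrow> nat \<Rightarrow> real" where
  "sinkhorn_plan_odd d K \<nu>\<^sub>0 \<nu>\<^sub>1 k i j =
     sinkhorn_u d K \<nu>\<^sub>0 \<nu>\<^sub>1 (Suc k) i * K i j * sinkhorn_v d K \<nu>\<^sub>0 \<nu>\<^sub>1 k j"

definition assoc_fun :: "nat \<Rightarrow> (nat \<Rightarrow> nat \<Rightarrow> real) \<Rightarrow> nat \<Rightarrow> real" where
  "assoc_fun d \<gamma> i = (\<Sum>j=1..d. \<gamma> i j * real j) / (\<Sum>j=1..d. \<gamma> i j) - real i"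

definition kernel_eta :: "nat \<Rightarrow> (nat \<Rightarrow> nat \<Rightarrow> real) \<Rightarrow> real" where
  "kernel_eta d K = Max {K i j * K i' j' / (K i' j * K i j') | i j i' j'.
     i \<in> {1..d} \<and> j \<in> {1..d} \<and> i' \<in> {1..d} \<and> j' \<in> {1..d}}"

definition contraction_coeff :: "nat \<Rightarrow> (nat \<Rightarrow> nat \<Rightarrow> real) \<Rightarrow> real" where
  "contraction_coeff d K = (sqrt (kernel_eta d K) - 1) / (sqrt (kernel_eta d K) + 1)"

definition sup_norm_on :: "'a set \<Rightarrow> ('a \<Rightarrow> real) \<Rightarrow> real" where
  "sup_norm_on S g = (SUP x\<in>S. \<bar>g x\<bar>)"

end

theory Submission imports Defs begin

text \<open>Moving mass \<open>t\<close> around a 4-cycle \<open>(i,j), (i',j'), (i,j'), (i',j)\<close> of entries of the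
  minimizer and letting \<open>t\<close> tend to 0 shows that \<open>\<gamma> i j / K i j\<close> has trivial cross ratios and is
  positive on the product of the supports, so \<open>\<gamma> i j = a i * K i j * b j\<close> there. Thus \<open>a, b\<close> solve
  the fixed point equations of Sinkhorn's iteration, and by the Birkhoff--Hopf theorem each half step
  contracts the oscillation of \<open>ln (v j / b j)\<close> (Hilbert's projective metric) by the factor \<open>\<lambda>(K)\<close>.
  Since \<open>assoc_fun\<close> only depends on the rows up to scaling, it is a difference of two means whose
  weights have log-ratio of small oscillation, which is bounded by that oscillation.\<close>

section \<open>The Birkhoff--Hopf contraction\<close>

text \<open>This is \<open>contraction_coeff\<close> as a function of the cross ratio bound alone,
  equal to tanh (ln \<eta> / 4) for \<eta> > 0. Separating it from the kernel lets one estimate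
  serve both for \<open>kernel_eta\<close> and for \<open>exp D\<close>.\<close>

definition cross_ratio_coeff :: "real \<Rightarrow> real" where
  "cross_ratio_coeff \<eta> = (sqrt \<eta> - 1) / (sqrt \<eta> + 1)"

text \<open>For the logarithm of a quotient of positive vectors, this bounds Hilbert's projective
  distance between them. An upper bound, unlike a maximum minus a minimum, passes directly from one
  half step to the next.\<close>

definition osc_le :: "'a set \<Rightarrow> ('a \<Rightarrow> real) \<Rightarrow> real \<Rightarrow> bool" where
  "osc_le T s D \<longleftrightarrow> (\<forall>j\<in>T. \<forall>k\<in>T. s j - s k \<le> D)"

lemma osc_leD: "osc_le T s D \<Longrightarrow> j \<in> T \<Longrightarrow> k \<in> T \<Longrightarrow> s j - s k \<le> D"
  by (simp add: osc_le_def)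

lemma osc_le_nonneg: "osc_le T s D \<Longrightarrow> T \<noteq> {} \<Longrightarrow> 0 \<le> D"
  by (force simp: osc_le_def)

lemma cross_ratio_coeff_nonneg: "1 \<le> \<eta> \<Longrightarrow> 0 \<le> cross_ratio_coeff \<eta>"
  by (simp add: cross_ratio_coeff_def)

lemma cross_ratio_coeff_less_1: "1 \<le> \<eta> \<Longrightarrow> cross_ratio_coeff \<eta> < 1"
  by (simp add: cross_ratio_coeff_def add_pos_pos)

text \<open>Multiplying \<open>1 - x \<le> exp (- x)\<close> by \<open>exp x\<close> at
  \<open>x = D / 2\<close> gives the bound. The sharp constant would be 1/4; only linearity in
  \<open>D\<close> matters later.\<close>

lemma cross_ratio_coeff_exp_le:
  assumes "0 \<le> D"
  shows "cross_ratio_coeff (exp D) \<le> D / 2"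
proof -
  have e: "sqrt (exp D) = exp (D / 2)"
    by (rule real_sqrt_unique) (simp_all flip: exp_of_nat_mult)
  have "1 - D / 2 \<le> exp (- (D / 2))"
    using exp_ge_add_one_self[of "- (D / 2)"] by simp
  then have "(1 - D / 2) * exp (D / 2) \<le> exp (- (D / 2)) * exp (D / 2)"
    by (intro mult_right_mono) auto
  also have "\<dots> = 1"
    by (simp flip: exp_add)
  finally have "exp (D / 2) - 1 \<le> D / 2 * (exp (D / 2) + 1)"
    using assms by (simp add: algebra_simps)
  then show ?thesis
    unfolding cross_ratio_coeff_def e by (simp add: divide_le_eq add_pos_pos)
qed

text \<open>This is where the square root in the coefficient comes from. With \<open>a\<close> and
  \<open>b\<close> the square roots of \<open>P * (1 - Q)\<close> and \<open>Q * (1 - P)\<close>,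
  one has \<open>P - Q = (a - b) * (a + b)\<close> and \<open>a + b \<le> 1\<close>, so
  \<open>P - Q\<close> is at most \<open>(a - b) / (a + b)\<close>, which increases with
  \<open>a / b \<le> sqrt \<eta>\<close>. Equality occurs when the odds of \<open>P\<close> and
  \<open>Q\<close> are \<open>sqrt \<eta>\<close> and \<open>1 / sqrt \<eta>\<close>.\<close>

lemma odds_ratio_diff_le:
  fixes P Q \<eta> :: real
  assumes "0 \<le> P" "P \<le> 1" "0 \<le> Q" "Q \<le> 1" "1 \<le> \<eta>"
    and odds: "P * (1 - Q) \<le> \<eta> * (Q * (1 - P))"
  shows "P - Q \<le> cross_ratio_coeff \<eta>"
proof (cases "P \<le> Q")
  case True
  then show ?thesis
    using cross_ratio_coeff_nonneg[OF \<open>1 \<le> \<eta>\<close>] by linarith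
next
  case False
  define a b where "a = sqrt (P * (1 - Q))" and "b = sqrt (Q * (1 - P))"
  have a2: "a\<^sup>2 = P * (1 - Q)" and b2: "b\<^sup>2 = Q * (1 - P)" and a0: "0 \<le> a" and b0: "0 \<le> b"
    using assms by (auto simp: a_def b_def)
  have "0 < a"
    using assms False by (auto simp: a_def intro!: mult_pos_pos)
  have ab: "a \<le> sqrt \<eta> * b"
    using odds by (simp add: a_def b_def flip: real_sqrt_mult)
  have dif: "P - Q = (a - b) * (a + b)"
    using a2 b2 by (simp add: algebra_simps power2_eq_square)
  have "a * b \<le> (P * (1 - P) + Q * (1 - Q)) / 2"
  proof -
    have "a * b = sqrt ((P * (1 - P)) * (Q * (1 - Q)))"
      by (simp add: a_def b_def mult_ac flip: real_sqrt_mult)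
    also have "\<dots> \<le> (P * (1 - P) + Q * (1 - Q)) / 2"
      by (rule arith_geo_mean_sqrt) (use assms in auto)
    finally show ?thesis .
  qed
  \<comment> \<open>Expanding the square and inserting the bound on \<open>a * b\<close> leaves
    \<open>1 - (P + Q - 1)\<^sup>2\<close>.\<close>
  then have "(a + b)\<^sup>2 \<le> 1"
    using a2 b2 zero_le_power2[of "P + Q - 1"] by (simp add: power2_eq_square algebra_simps)
  then have s1: "a + b \<le> 1"
    using a0 b0 by (simp add: power_le_one_iff abs_square_le_1)
  have "0 < (a - b) * (a + b)"
    using dif False by simp
  then have "0 \<le> a - b"
    using \<open>0 < a\<close> b0 by (simp add: zero_less_mult_iff)
  then have "P - Q \<le> (a - b) / (a + b)"
  proof -
    have "(a - b) * ((a + b) * (a + b)) \<le> (a - b) * 1"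
      using \<open>0 \<le> a - b\<close> s1 a0 b0 by (intro mult_left_mono mult_le_one) auto
    then show ?thesis
      using \<open>0 < a\<close> b0 dif by (simp add: pos_le_divide_eq mult.assoc)
  qed
  also have "\<dots> \<le> cross_ratio_coeff \<eta>"
  proof -
    have "(a - b) * (sqrt \<eta> + 1) \<le> (sqrt \<eta> - 1) * (a + b)"
      using ab by (simp add: algebra_simps)
    moreover have "0 < sqrt \<eta> + 1"
      using \<open>1 \<le> \<eta>\<close> by (simp add: add_pos_pos)
    ultimately show ?thesis
      unfolding cross_ratio_coeff_def using \<open>0 < a\<close> b0 by (simp add: divide_simps)
  qed
  finally show ?thesis .
qed

text \<open>The difference of two means is at most the total variation distance of the normalized
  weights times the oscillation of \<open>s\<close>. The cross ratio condition bounds that distance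
  through \<open>odds_ratio_diff_le\<close>.\<close>

lemma mean_diff_le:
  fixes p q s :: "'a \<Rightarrow> real"
  assumes fin: "finite T" and ne: "T \<noteq> {}"
    and p: "\<And>j. j \<in> T \<Longrightarrow> 0 < p j" and q: "\<And>j. j \<in> T \<Longrightarrow> 0 < q j"
    and cross: "\<And>j k. j \<in> T \<Longrightarrow> k \<in> T \<Longrightarrow> p j * q k \<le> \<eta> * (q j * p k)"
    and osc: "osc_le T s D"
  shows "(\<Sum>j\<in>T. p j * s j) / (\<Sum>j\<in>T. p j) - (\<Sum>j\<in>T. q j * s j) / (\<Sum>j\<in>T. q j)
    \<le> cross_ratio_coeff \<eta> * D"
proof -
  define P Q where "P = (\<Sum>j\<in>T. p j)" and "Q = (\<Sum>j\<in>T. q j)"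
  have P0: "0 < P" and Q0: "0 < Q"
    unfolding P_def Q_def using fin ne p q by (auto intro!: sum_pos)
  \<comment> \<open>On this set the total variation distance of the normalized weights is attained,
    as \<open>PA - QA\<close>.\<close>
  define A where "A = {j\<in>T. q j / Q < p j / P}"
  have A: "A \<subseteq> T" "finite A"
    using fin by (auto simp: A_def)
  define PA QA where "PA = (\<Sum>j\<in>A. p j) / P" and "QA = (\<Sum>j\<in>A. q j) / Q"
  have split: "(\<Sum>j\<in>A. f j) + (\<Sum>j\<in>T - A. f j) = (\<Sum>j\<in>T. f j)" for f :: "'a \<Rightarrow> real"
    using sum.subset_diff[OF A(1) fin, of f] by simp
  have pos: "0 \<le> (\<Sum>j\<in>A. p j)" "0 \<le> (\<Sum>j\<in>A. q j)" "0 \<le> (\<Sum>j\<in>T - A. p j)" "0 \<le> (\<Sum>j\<in>T - A. q j)"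
    using A(1) p q by (auto intro!: sum_nonneg simp: less_imp_le subset_iff)
  have PA': "1 - PA = (\<Sum>j\<in>T - A. p j) / P" and QA': "1 - QA = (\<Sum>j\<in>T - A. q j) / Q"
    using split[of p] split[of q] P0 Q0
    by (simp_all add: PA_def QA_def P_def[symmetric] Q_def[symmetric] field_simps)
  obtain j0 where j0: "j0 \<in> T"
    using ne by auto
  have D0: "0 \<le> D"
    using osc_le_nonneg[OF osc ne] .
  have eta: "1 \<le> \<eta>"
    using cross[OF j0 j0] p[OF j0] q[OF j0] by (simp add: mult.commute)
  \<comment> \<open>Summing the cross ratio condition over \<open>A\<close> times its complement
    turns it into a comparison of the odds of \<open>A\<close> under the two normalized
    weights.\<close>
  have "(\<Sum>j\<in>A. p j) * (\<Sum>k\<in>T - A. q k) = (\<Sum>j\<in>A. \<Sum>k\<in>T - A. p j * q k)"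
    by (rule sum_product)
  also have "\<dots> \<le> (\<Sum>j\<in>A. \<Sum>k\<in>T - A. \<eta> * (q j * p k))"
    using A(1) by (intro sum_mono cross) auto
  also have "\<dots> = \<eta> * ((\<Sum>j\<in>A. q j) * (\<Sum>k\<in>T - A. p k))"
    by (simp only: sum_product) (simp only: sum_distrib_left)
  finally have "(\<Sum>j\<in>A. p j) * (\<Sum>k\<in>T - A. q k) / (P * Q)
      \<le> \<eta> * ((\<Sum>j\<in>A. q j) * (\<Sum>k\<in>T - A. p k)) / (P * Q)"
    using P0 Q0 by (intro divide_right_mono) auto
  then have odds: "PA * (1 - QA) \<le> \<eta> * (QA * (1 - PA))"
    unfolding PA' QA' by (simp add: PA_def QA_def mult_ac)
  have PQ: "PA - QA \<le> cross_ratio_coeff \<eta>"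
  proof (rule odds_ratio_diff_le[OF _ _ _ _ eta odds])
    show "0 \<le> PA" "0 \<le> QA"
      using pos P0 Q0 by (auto simp: PA_def QA_def)
    have "0 \<le> 1 - PA" "0 \<le> 1 - QA"
      unfolding PA' QA' using pos P0 Q0 by simp_all
    then show "PA \<le> 1" "QA \<le> 1"
      by simp_all
  qed
  define m where "m = Min (s ` T)"
  have m: "m \<le> s j" "s j - m \<le> D" if "j \<in> T" for j
  proof -
    show "m \<le> s j"
      using fin that by (simp add: m_def)
    have "m \<in> s ` T"
      unfolding m_def using fin ne by (intro Min_in) auto
    then show "s j - m \<le> D"
      using osc_leD[OF osc that] by auto
  qed
  \<comment> \<open>Since the weight differences sum to zero, the minimum \<open>m\<close> may be
    subtracted from \<open>s\<close>. The terms outside \<open>A\<close> are then nonpositive and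
    those in \<open>A\<close> have a factor of at most \<open>D\<close>.\<close>
  have norm1: "(\<Sum>j\<in>T. p j / P - q j / Q) = 0"
    using P0 Q0 by (simp add: sum_subtractf P_def Q_def flip: sum_divide_distrib)
  have "(\<Sum>j\<in>T. p j * s j) / P - (\<Sum>j\<in>T. q j * s j) / Q = (\<Sum>j\<in>T. (p j / P - q j / Q) * s j)"
    by (simp add: sum_divide_distrib sum_subtractf left_diff_distrib)
  also have "\<dots> = (\<Sum>j\<in>T. (p j / P - q j / Q) * (s j - m))"
    using norm1 by (simp add: right_diff_distrib sum_subtractf flip: sum_distrib_right)
  also have "\<dots> = (\<Sum>j\<in>A. (p j / P - q j / Q) * (s j - m)) + (\<Sum>j\<in>T - A. (p j / P - q j / Q) * (s j - m))"
    by (rule split[symmetric])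
  also have "\<dots> \<le> (\<Sum>j\<in>A. (p j / P - q j / Q) * D) + 0"
  proof (intro add_mono sum_mono sum_nonpos mult_left_mono mult_nonpos_nonneg)
    fix j assume "j \<in> A"
    then show "s j - m \<le> D" "0 \<le> p j / P - q j / Q"
      using m by (auto simp: A_def)
  next
    fix j assume "j \<in> T - A"
    then show "p j / P - q j / Q \<le> 0" "0 \<le> s j - m"
      using m by (auto simp: A_def)
  qed
  also have "\<dots> = (PA - QA) * D"
    by (simp add: PA_def QA_def sum_subtractf sum_divide_distrib flip: sum_distrib_right)
  also have "\<dots> \<le> cross_ratio_coeff \<eta> * D"
    using PQ D0 by (intro mult_right_mono)
  finally show ?thesis
    unfolding P_def Q_def .
qed

text \<open>Interpolate by \<open>exp (t * s)\<close>, \<open>0 \<le> t \<le> 1\<close>: tilting both weights by the same factor keeps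
  their cross ratios, so \<open>mean_diff_le\<close> bounds the derivative in \<open>t\<close> uniformly.\<close>

lemma ln_sum_exp_contraction:
  fixes p q s :: "'a \<Rightarrow> real"
  assumes fin: "finite T" and ne: "T \<noteq> {}"
    and p: "\<And>j. j \<in> T \<Longrightarrow> 0 < p j" and q: "\<And>j. j \<in> T \<Longrightarrow> 0 < q j"
    and cross: "\<And>j k. j \<in> T \<Longrightarrow> k \<in> T \<Longrightarrow> p j * q k \<le> \<eta> * (q j * p k)"
    and osc: "osc_le T s D"
  shows "(ln (\<Sum>j\<in>T. p j * exp (s j)) - ln (\<Sum>j\<in>T. q j * exp (s j)))
    - (ln (\<Sum>j\<in>T. p j) - ln (\<Sum>j\<in>T. q j)) \<le> cross_ratio_coeff \<eta> * D"
proof -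
  define Z where "Z r t = (\<Sum>j\<in>T. r j * exp (t * s j))" for r :: "'a \<Rightarrow> real" and t
  define F where "F t = ln (Z p t) - ln (Z q t)" for t
  \<comment> \<open>The derivative of \<open>ln (Z r t)\<close> is the mean of \<open>s\<close>
    under the tilted weights, so \<open>F'\<close> has the form treated by
    \<open>mean_diff_le\<close>.\<close>
  define F' where "F' t = (\<Sum>j\<in>T. (p j * exp (t * s j)) * s j) / Z p t
      - (\<Sum>j\<in>T. (q j * exp (t * s j)) * s j) / Z q t" for t
  have Zpos: "0 < Z p t" "0 < Z q t" for t
    unfolding Z_def using fin ne p q by (auto intro!: sum_pos)
  have dZ: "(Z r has_real_derivative (\<Sum>j\<in>T. (r j * exp (t * s j)) * s j)) (at t)" for r t
    unfolding Z_def by (auto intro!: derivative_eq_intros sum.cong)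
  have dF: "(F has_real_derivative F' t) (at t)" for t
    unfolding F_def F'_def
    by (rule derivative_eq_intros dZ Zpos refl | simp)+
  have "\<exists>t. 0 < t \<and> t < 1 \<and> F 1 - F 0 = (1 - 0) * F' t"
    using dF by (intro MVT2) auto
  then obtain t where t: "F 1 - F 0 = F' t"
    by auto
  also have "F' t \<le> cross_ratio_coeff \<eta> * D"
    unfolding F'_def Z_def
  proof (rule mean_diff_le[OF fin ne _ _ _ osc])
    fix j k assume jk: "j \<in> T" "k \<in> T"
    have "p j * q k * (exp (t * s j) * exp (t * s k)) \<le> \<eta> * (q j * p k) * (exp (t * s j) * exp (t * s k))"
      by (intro mult_right_mono cross jk) auto
    then show "p j * exp (t * s j) * (q k * exp (t * s k)) \<le> \<eta> * (q j * exp (t * s j) * (p k * exp (t * s k)))"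
      by (simp add: mult_ac)
  qed (use p q in auto)
  finally show ?thesis
    by (simp add: F_def Z_def)
qed

text \<open>One half step of the iteration. By \<open>eq\<close>, \<open>u i / a i\<close> is the
  quotient of the row sums of \<open>K\<close> against \<open>b\<close> and against
  \<open>v\<close>. Comparing two rows means comparing the weights \<open>K i j * b j\<close> and
  \<open>K i' j * b j\<close> before and after tilting by \<open>v j / b j\<close>, and the factors
  \<open>b j\<close> leave the cross ratios of the rows unchanged.\<close>

lemma scaling_step_contraction:
  fixes K :: "'a \<Rightarrow> 'b \<Rightarrow> real"
  assumes fin: "finite T" and ne: "T \<noteq> {}"
    and K: "\<And>i j. i \<in> S \<Longrightarrow> j \<in> T \<Longrightarrow> 0 < K i j"
    and cross: "\<And>i i' j j'. i \<in> S \<Longrightarrow> i' \<in> S \<Longrightarrow> j \<in> T \<Longrightarrow> j' \<in> T \<Longrightarrow>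
      K i j * K i' j' \<le> \<eta> * (K i' j * K i j')"
    and v: "\<And>j. j \<in> T \<Longrightarrow> 0 < v j" and b: "\<And>j. j \<in> T \<Longrightarrow> 0 < b j"
    and u: "\<And>i. i \<in> S \<Longrightarrow> 0 < u i" and a: "\<And>i. i \<in> S \<Longrightarrow> 0 < a i"
    and eq: "\<And>i. i \<in> S \<Longrightarrow> u i * (\<Sum>j\<in>T. K i j * v j) = a i * (\<Sum>j\<in>T. K i j * b j)"
    and osc: "osc_le T (\<lambda>j. ln (v j) - ln (b j)) D"
  shows "osc_le S (\<lambda>i. ln (u i) - ln (a i)) (cross_ratio_coeff \<eta> * D)"
  unfolding osc_le_def
proof (intro ballI)
  fix i' i assume i: "i' \<in> S" "i \<in> S"
  define s where "s = (\<lambda>j. ln (v j) - ln (b j))"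
  have pos: "0 < (\<Sum>j\<in>T. K l j * v j)" "0 < (\<Sum>j\<in>T. K l j * b j)" if "l \<in> S" for l
    using fin ne K[OF that] v b by (auto intro!: sum_pos)
  have log: "ln (u l) - ln (a l) = ln (\<Sum>j\<in>T. K l j * b j) - ln (\<Sum>j\<in>T. K l j * v j)" if "l \<in> S" for l
  proof -
    have "ln (u l * (\<Sum>j\<in>T. K l j * v j)) = ln (a l * (\<Sum>j\<in>T. K l j * b j))"
      using eq[OF that] by simp
    then show ?thesis
      using u[OF that] a[OF that] pos[OF that] by (simp add: ln_mult)
  qed
  have v_eq: "(\<Sum>j\<in>T. K l j * b j * exp (s j)) = (\<Sum>j\<in>T. K l j * v j)" if "l \<in> S" for l
    using v b by (intro sum.cong) (simp_all add: s_def exp_diff order_less_imp_not_eq2)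
  \<comment> \<open>The scaling \<open>u\<close> is inverse to the row sums, hence \<open>i\<close>
    and \<open>i'\<close> exchange their roles here.\<close>
  have "(ln (\<Sum>j\<in>T. K i j * b j * exp (s j)) - ln (\<Sum>j\<in>T. K i' j * b j * exp (s j)))
    - (ln (\<Sum>j\<in>T. K i j * b j) - ln (\<Sum>j\<in>T. K i' j * b j)) \<le> cross_ratio_coeff \<eta> * D"
  proof (rule ln_sum_exp_contraction[OF fin ne])
    fix j k assume jk: "j \<in> T" "k \<in> T"
    have "K i j * K i' k * (b j * b k) \<le> \<eta> * (K i' j * K i k) * (b j * b k)"
      using b jk by (intro mult_right_mono cross i jk) (simp add: less_imp_le)
    then show "K i j * b j * (K i' k * b k) \<le> \<eta> * (K i' j * b j * (K i k * b k))"
      by (simp add: mult_ac)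
  qed (use K i b osc in \<open>auto simp: s_def\<close>)
  then show "ln (u i') - ln (a i') - (ln (u i) - ln (a i)) \<le> cross_ratio_coeff \<eta> * D"
    using log i by (simp add: v_eq)
qed

section \<open>Means under weights with nearby logarithms\<close>

lemma osc_le_swap: "osc_le T (\<lambda>j. f j - g j) D \<Longrightarrow> osc_le T (\<lambda>j. g j - f j) D"
  by (force simp: osc_le_def)

lemma osc_le_exists:
  fixes s :: "'a \<Rightarrow> real"
  assumes "finite T"
  shows "\<exists>D. osc_le T s D"
proof -
  have "s j - s k \<le> 2 * (\<Sum>l\<in>T. \<bar>s l\<bar>)" if "j \<in> T" "k \<in> T" for j k
    using member_le_sum[OF that(1), of "\<lambda>l. \<bar>s l\<bar>"] member_le_sum[OF that(2), of "\<lambda>l. \<bar>s l\<bar>"] assms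
    by fastforce
  then show ?thesis
    unfolding osc_le_def by blast
qed

text \<open>A log-ratio of oscillation at most \<open>D\<close> means cross ratios at most
  \<open>exp D\<close>, so \<open>mean_diff_le\<close> applies with \<open>exp D\<close> for \<eta>,
  and its coefficient is at most linear in \<open>D\<close>.\<close>

lemma mean_diff_le_log_osc:
  fixes p q s :: "'a \<Rightarrow> real"
  assumes fin: "finite T" and ne: "T \<noteq> {}"
    and p: "\<And>j. j \<in> T \<Longrightarrow> 0 < p j" and q: "\<And>j. j \<in> T \<Longrightarrow> 0 < q j"
    and log: "osc_le T (\<lambda>j. ln (p j) - ln (q j)) D"
    and osc: "osc_le T s L"
  shows "(\<Sum>j\<in>T. p j * s j) / (\<Sum>j\<in>T. p j) - (\<Sum>j\<in>T. q j * s j) / (\<Sum>j\<in>T. q j) \<le> D / 2 * L"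
proof -
  have "(\<Sum>j\<in>T. p j * s j) / (\<Sum>j\<in>T. p j) - (\<Sum>j\<in>T. q j * s j) / (\<Sum>j\<in>T. q j)
    \<le> cross_ratio_coeff (exp D) * L"
  proof (rule mean_diff_le[OF fin ne p q _ osc])
    fix j k assume jk: "j \<in> T" "k \<in> T"
    have "p j * q k = exp (ln (p j) + ln (q k))"
      using p q jk by (simp add: exp_add)
    also have "\<dots> \<le> exp (D + (ln (q j) + ln (p k)))"
      using osc_leD[OF log jk] by simp
    also have "\<dots> = exp D * (q j * p k)"
      using p q jk by (simp add: exp_add)
    finally show "p j * q k \<le> exp D * (q j * p k)" .
  qed
  also have "\<dots> \<le> D / 2 * L"
    using osc_le_nonneg[OF log ne] osc_le_nonneg[OF osc ne]
    by (intro mult_right_mono cross_ratio_coeff_exp_le)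
  finally show ?thesis .
qed

lemma abs_mean_diff_le_log_osc:
  fixes p q s :: "'a \<Rightarrow> real"
  assumes "finite T" "T \<noteq> {}"
    and "\<And>j. j \<in> T \<Longrightarrow> 0 < p j" "\<And>j. j \<in> T \<Longrightarrow> 0 < q j"
    and "osc_le T (\<lambda>j. ln (p j) - ln (q j)) D" "osc_le T s L"
  shows "\<bar>(\<Sum>j\<in>T. p j * s j) / (\<Sum>j\<in>T. p j) - (\<Sum>j\<in>T. q j * s j) / (\<Sum>j\<in>T. q j)\<bar> \<le> D / 2 * L"
  using mean_diff_le_log_osc[OF assms]
    mean_diff_le_log_osc[OF assms(1,2,4,3) osc_le_swap[OF assms(5)] assms(6)]
  by linarith

section \<open>Structure of the minimizer\<close>

text \<open>Convexity of \<open>x * (ln x - 1)\<close>, whose derivative is \<open>ln x\<close>. The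
  tangent is taken at the positive point \<open>y\<close>, so that \<open>x\<close>, an entry of the
  minimizer, is allowed to vanish.\<close>

lemma entropy_tangent_le:
  fixes x y :: real
  assumes "0 \<le> x" "0 < y"
  shows "y * (ln y - 1) - x * (ln x - 1) \<le> (y - x) * ln y"
proof (cases "x = 0")
  case False
  with assms have "x * (ln y - ln x) \<le> x * (y / x - 1)"
    using ln_le_minus_one[of "y / x"] by (intro mult_left_mono) (simp_all add: ln_div)
  also have "\<dots> = y - x"
    using False by (simp add: right_diff_distrib)
  finally show ?thesis
    by (simp add: algebra_simps)
qed (use assms in \<open>simp add: algebra_simps\<close>)

lemma gibbs_kernel_pos: "0 < gibbs_kernel \<epsilon> i j"
  by (simp add: gibbs_kernel_def)

lemma sum_of_bool_diff:
  fixes g :: "'a \<Rightarrow> real"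
  assumes "finite A" "j \<in> A" "j' \<in> A"
  shows "(\<Sum>l\<in>A. (of_bool (l = j) - of_bool (l = j')) * g l) = g j - g j'"
proof -
  have "(\<Sum>l\<in>A. (of_bool (l = j) - of_bool (l = j')) * g l)
      = (\<Sum>l\<in>A. (if l = j then g l else 0) - (if l = j' then g l else 0))"
    by (intro sum.cong) auto
  then show ?thesis
    using assms by (simp add: sum_subtractf)
qed

lemma transport_plansD:
  assumes "\<gamma> \<in> transport_plans d \<nu>\<^sub>0 \<nu>\<^sub>1"
  shows "i \<in> {1..d} \<Longrightarrow> j \<in> {1..d} \<Longrightarrow> 0 \<le> \<gamma> i j"
    and "i \<in> {1..d} \<Longrightarrow> (\<Sum>j=1..d. \<gamma> i j) = \<nu>\<^sub>0 i"
    and "j \<in> {1..d} \<Longrightarrow> (\<Sum>i=1..d. \<gamma> i j) = \<nu>\<^sub>1 j"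
  using assms unfolding transport_plans_def by blast+

text \<open>Moving mass \<open>t\<close> from \<open>(i, j')\<close> and \<open>(i', j)\<close> to
  \<open>(i, j)\<close> and \<open>(i', j')\<close> preserves both marginals. By minimality the cost
  does not decrease, and convexity bounds its change by \<open>t\<close> times the derivative at the
  perturbed plan. That derivative is therefore nonnegative, and exponentiating it gives the
  claim.\<close>

lemma minimizer_cycle_le_perturbed:
  assumes eps: "0 < \<epsilon>"
    and min: "is_arg_min (regularized_cost d \<epsilon>) (\<lambda>\<gamma>. \<gamma> \<in> transport_plans d \<nu>\<^sub>0 \<nu>\<^sub>1) \<gamma>"
    and idx: "i \<in> {1..d}" "i' \<in> {1..d}" "j \<in> {1..d}" "j' \<in> {1..d}" "i \<noteq> i'" "j \<noteq> j'"
    and t: "0 < t" "t < \<gamma> i j'" "t < \<gamma> i' j"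
  shows "(\<gamma> i j' - t) * (\<gamma> i' j - t) * (gibbs_kernel \<epsilon> i j * gibbs_kernel \<epsilon> i' j')
    \<le> (\<gamma> i j + t) * (\<gamma> i' j' + t) * (gibbs_kernel \<epsilon> i j' * gibbs_kernel \<epsilon> i' j)"
proof -
  let ?K = "gibbs_kernel \<epsilon>"
  \<comment> \<open>The sign pattern of the 4-cycle, written as a product of a row and a column
    difference so that its row and column sums vanish.\<close>
  define E :: "nat \<Rightarrow> nat \<Rightarrow> real"
    where "E k l = (of_bool (k = i) - of_bool (k = i')) * (of_bool (l = j) - of_bool (l = j'))" for k l
  define \<delta> where "\<delta> k l = \<gamma> k l + t * E k l" for k l
  have plan: "\<gamma> \<in> transport_plans d \<nu>\<^sub>0 \<nu>\<^sub>1"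
    using min by (simp add: is_arg_min_def)
  note \<gamma>0 = transport_plansD(1)[OF plan]
  have \<delta>_at: "\<delta> i j = \<gamma> i j + t" "\<delta> i' j' = \<gamma> i' j' + t" "\<delta> i j' = \<gamma> i j' - t" "\<delta> i' j = \<gamma> i' j - t"
    using idx by (auto simp: \<delta>_def E_def)
  note row_diff = sum_of_bool_diff[OF finite_atLeastAtMost idx(1,2)]
    and col_diff = sum_of_bool_diff[OF finite_atLeastAtMost idx(3,4)]
  have E_cases: "E k l = 0 \<or> (k, l) \<in> {(i, j), (i', j'), (i, j'), (i', j)}" for k l
    by (auto simp: E_def)
  have \<delta>pos: "0 < \<delta> k l" if "k \<in> {1..d}" "l \<in> {1..d}" "E k l \<noteq> 0" for k l
  proof -
    have "0 < \<delta> i j" "0 < \<delta> i' j'" "0 < \<delta> i j'" "0 < \<delta> i' j"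
      unfolding \<delta>_at using t \<gamma>0[OF idx(1,3)] \<gamma>0[OF idx(2,4)] by linarith+
    then show ?thesis
      using E_cases[of k l] that(3) by auto
  qed
  have "\<delta> \<in> transport_plans d \<nu>\<^sub>0 \<nu>\<^sub>1"
    unfolding transport_plans_def
  proof (intro CollectI conjI ballI)
    fix k l assume "k \<in> {1..d}" "l \<in> {1..d}"
    then show "0 \<le> \<delta> k l"
      using \<delta>pos[of k l] \<gamma>0[of k l] by (cases "E k l = 0") (auto simp: \<delta>_def)
  next
    fix k assume k: "k \<in> {1..d}"
    have "(\<Sum>l=1..d. E k l) = 0"
      using col_diff[of "\<lambda>_. 1"] by (simp add: E_def flip: sum_distrib_left)
    then show "(\<Sum>l=1..d. \<delta> k l) = \<nu>\<^sub>0 k"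
      using transport_plansD(2)[OF plan k] by (simp only: \<delta>_def sum.distrib mult_zero_right add_0_right flip: sum_distrib_left)
  next
    fix l assume l: "l \<in> {1..d}"
    have "(\<Sum>k=1..d. E k l) = 0"
      using row_diff[of "\<lambda>_. 1"] by (simp add: E_def flip: sum_distrib_right)
    then show "(\<Sum>k=1..d. \<delta> k l) = \<nu>\<^sub>1 l"
      using transport_plansD(3)[OF plan l] by (simp only: \<delta>_def sum.distrib mult_zero_right add_0_right flip: sum_distrib_left)
  qed
  then have "regularized_cost d \<epsilon> \<gamma> \<le> regularized_cost d \<epsilon> \<delta>"
    using min by (simp add: is_arg_min_linorder)
  \<comment> \<open>The cost splits into one convex function per entry, so increments can be
    estimated entry by entry.\<close>
  define \<Phi> where "\<Phi> k l x = (real k - real l)\<^sup>2 * x + \<epsilon> * (x * (ln x - 1))" for k l x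
  have cost: "regularized_cost d \<epsilon> \<beta> = (\<Sum>k=1..d. \<Sum>l=1..d. \<Phi> k l (\<beta> k l))" for \<beta>
    by (simp add: regularized_cost_def plan_entropy_def \<Phi>_def sum.distrib sum_distrib_left)
  \<comment> \<open>Up to the factor \<epsilon>, \<open>w k l\<close> is the partial derivative of
    the cost at \<open>\<delta>\<close>, because the squared distance equals - \<epsilon> times the
    logarithm of the kernel.\<close>
  define w where "w k l = ln (\<delta> k l) - ln (?K k l)" for k l
  have "0 \<le> (\<Sum>k=1..d. \<Sum>l=1..d. \<Phi> k l (\<delta> k l) - \<Phi> k l (\<gamma> k l))"
    using \<open>regularized_cost d \<epsilon> \<gamma> \<le> _\<close> by (simp add: cost sum_subtractf)
  also have "\<dots> \<le> (\<Sum>k=1..d. \<Sum>l=1..d. t * \<epsilon> * (E k l * w k l))"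
  proof (intro sum_mono)
    fix k l assume kl: "k \<in> {1..d}" "l \<in> {1..d}"
    show "\<Phi> k l (\<delta> k l) - \<Phi> k l (\<gamma> k l) \<le> t * \<epsilon> * (E k l * w k l)"
    proof (cases "E k l = 0")
      case False
      have K: "(real k - real l)\<^sup>2 = - \<epsilon> * ln (?K k l)"
        using eps by (simp add: gibbs_kernel_def)
      have "\<Phi> k l (\<delta> k l) - \<Phi> k l (\<gamma> k l) = (real k - real l)\<^sup>2 * (\<delta> k l - \<gamma> k l)
          + \<epsilon> * (\<delta> k l * (ln (\<delta> k l) - 1) - \<gamma> k l * (ln (\<gamma> k l) - 1))"
        by (simp add: \<Phi>_def algebra_simps)
      also have "\<dots> \<le> (real k - real l)\<^sup>2 * (\<delta> k l - \<gamma> k l) + \<epsilon> * ((\<delta> k l - \<gamma> k l) * ln (\<delta> k l))"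
        using eps \<gamma>0[OF kl] \<delta>pos[OF kl False]
        by (intro add_left_mono mult_left_mono entropy_tangent_le) auto
      also have "\<dots> = t * \<epsilon> * (E k l * w k l)"
        unfolding K w_def by (simp add: \<delta>_def algebra_simps)
      finally show ?thesis .
    qed (simp add: \<delta>_def)
  qed
  also have "\<dots> = t * \<epsilon> * (w i j - w i j' - (w i' j - w i' j'))"
  proof -
    have "(\<Sum>l=1..d. E k l * w k l) = (of_bool (k = i) - of_bool (k = i')) * (w k j - w k j')" for k
      by (simp only: E_def mult.assoc col_diff flip: sum_distrib_left)
    then show ?thesis
      by (simp only: row_diff flip: sum_distrib_left)
  qed
  finally have "0 \<le> w i j - w i j' - (w i' j - w i' j')"
    using mult_pos_pos[OF t(1) eps] by (metis zero_le_mult_iff not_le)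
  moreover have pos: "0 < \<gamma> i j + t" "0 < \<gamma> i' j' + t" "0 < \<gamma> i j' - t" "0 < \<gamma> i' j - t"
    using t \<gamma>0[OF idx(1,3)] \<gamma>0[OF idx(2,4)] by linarith+
  ultimately have "ln ((\<gamma> i j' - t) * (\<gamma> i' j - t) * (?K i j * ?K i' j'))
    \<le> ln ((\<gamma> i j + t) * (\<gamma> i' j' + t) * (?K i j' * ?K i' j))"
    using gibbs_kernel_pos[of \<epsilon>] by (simp add: w_def \<delta>_at ln_mult mult_pos_pos order_less_imp_not_eq2)
  then show ?thesis
    using pos gibbs_kernel_pos[of \<epsilon>] by (simp add: mult_pos_pos)
qed

text \<open>The limit of \<open>minimizer_cycle_le_perturbed\<close> as \<open>t\<close> decreases
  to 0. If indices coincide the two sides agree, and if a donating entry vanishes the left side is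
  0.\<close>

lemma minimizer_cycle_le:
  assumes eps: "0 < \<epsilon>"
    and min: "is_arg_min (regularized_cost d \<epsilon>) (\<lambda>\<gamma>. \<gamma> \<in> transport_plans d \<nu>\<^sub>0 \<nu>\<^sub>1) \<gamma>"
    and idx: "i \<in> {1..d}" "i' \<in> {1..d}" "j \<in> {1..d}" "j' \<in> {1..d}"
  shows "\<gamma> i j' * \<gamma> i' j * (gibbs_kernel \<epsilon> i j * gibbs_kernel \<epsilon> i' j')
    \<le> \<gamma> i j * \<gamma> i' j' * (gibbs_kernel \<epsilon> i j' * gibbs_kernel \<epsilon> i' j)"
proof -
  have plan: "\<gamma> \<in> transport_plans d \<nu>\<^sub>0 \<nu>\<^sub>1"
    using min by (simp add: is_arg_min_def)
  note \<gamma>0 = transport_plansD(1)[OF plan]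
  consider "i = i' \<or> j = j'" | "\<gamma> i j' = 0 \<or> \<gamma> i' j = 0" | "i \<noteq> i'" "j \<noteq> j'" "0 < \<gamma> i j'" "0 < \<gamma> i' j"
    using \<gamma>0[OF idx(1,4)] \<gamma>0[OF idx(2,3)] by linarith
  then show ?thesis
  proof cases
    case 1
    then show ?thesis by (auto simp: mult_ac)
  next
    case 2
    then show ?thesis
      using \<gamma>0[OF idx(1,3)] \<gamma>0[OF idx(2,4)] gibbs_kernel_pos[of \<epsilon>] by (auto intro!: mult_nonneg_nonneg simp: less_imp_le)
  next
    case 3
    define m where "m = min (\<gamma> i j') (\<gamma> i' j)"
    have "\<forall>\<^sub>F t in at_right 0. t \<in> {0<..<m}"
      using 3 by (intro eventually_at_right_real) (simp add: m_def)
    then have ev: "\<forall>\<^sub>F t in at_right 0. (\<gamma> i j' - t) * (\<gamma> i' j - t) * (gibbs_kernel \<epsilon> i j * gibbs_kernel \<epsilon> i' j')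
        \<le> (\<gamma> i j + t) * (\<gamma> i' j' + t) * (gibbs_kernel \<epsilon> i j' * gibbs_kernel \<epsilon> i' j)"
      by eventually_elim (use 3 in \<open>auto simp: m_def intro!: minimizer_cycle_le_perturbed[OF eps min idx]\<close>)
    have lhs: "((\<lambda>t. (\<gamma> i j' - t) * (\<gamma> i' j - t) * (gibbs_kernel \<epsilon> i j * gibbs_kernel \<epsilon> i' j'))
        \<longlongrightarrow> (\<gamma> i j' - 0) * (\<gamma> i' j - 0) * (gibbs_kernel \<epsilon> i j * gibbs_kernel \<epsilon> i' j')) (at_right 0)"
      by (intro tendsto_intros)
    have rhs: "((\<lambda>t. (\<gamma> i j + t) * (\<gamma> i' j' + t) * (gibbs_kernel \<epsilon> i j' * gibbs_kernel \<epsilon> i' j))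
        \<longlongrightarrow> (\<gamma> i j + 0) * (\<gamma> i' j' + 0) * (gibbs_kernel \<epsilon> i j' * gibbs_kernel \<epsilon> i' j)) (at_right 0)"
      by (intro tendsto_intros)
    show ?thesis
      using tendsto_le[OF _ rhs lhs ev] by simp
  qed
qed

section \<open>Supports of the marginals and of the plans\<close>

lemma vec_eq_0_off_support:
  assumes "prob_vector d \<nu>" "i \<in> {1..d}" "i \<notin> vec_support d \<nu>"
  shows "\<nu> i = 0"
  using assms unfolding prob_vector_def vec_support_def by (metis (no_types, lifting) less_eq_real_def mem_Collect_eq)

lemma transport_plan_off_support:
  assumes "\<gamma> \<in> transport_plans d \<nu>\<^sub>0 \<nu>\<^sub>1" "prob_vector d \<nu>\<^sub>0" "prob_vector d \<nu>\<^sub>1"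
    and ij: "i \<in> {1..d}" "j \<in> {1..d}"
    and off: "i \<notin> vec_support d \<nu>\<^sub>0 \<or> j \<notin> vec_support d \<nu>\<^sub>1"
  shows "\<gamma> i j = 0"
proof -
  note \<gamma> = transport_plansD(1)[OF assms(1)]
  have "(\<Sum>l=1..d. \<gamma> i l) = 0 \<or> (\<Sum>k=1..d. \<gamma> k j) = 0"
    using off transport_plansD(2,3)[OF assms(1)] ij
      vec_eq_0_off_support[OF assms(2) ij(1)] vec_eq_0_off_support[OF assms(3) ij(2)]
    by metis
  then show ?thesis
    using \<gamma> ij by (subst (asm) (1 2) sum_nonneg_eq_0_iff) auto
qed

lemma transport_plan_sums_support:
  assumes "\<gamma> \<in> transport_plans d \<nu>\<^sub>0 \<nu>\<^sub>1" "prob_vector d \<nu>\<^sub>0" "prob_vector d \<nu>\<^sub>1"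
  shows "i \<in> {1..d} \<Longrightarrow> (\<Sum>j\<in>vec_support d \<nu>\<^sub>1. \<gamma> i j) = \<nu>\<^sub>0 i"
    and "j \<in> {1..d} \<Longrightarrow> (\<Sum>i\<in>vec_support d \<nu>\<^sub>0. \<gamma> i j) = \<nu>\<^sub>1 j"
proof -
  assume i: "i \<in> {1..d}"
  have "(\<Sum>j\<in>vec_support d \<nu>\<^sub>1. \<gamma> i j) = (\<Sum>j=1..d. \<gamma> i j)"
    using transport_plan_off_support[OF assms i] by (intro sum.mono_neutral_left) (auto simp: vec_support_def)
  then show "(\<Sum>j\<in>vec_support d \<nu>\<^sub>1. \<gamma> i j) = \<nu>\<^sub>0 i"
    using transport_plansD(2)[OF assms(1) i] by simp
next
  assume j: "j \<in> {1..d}"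
  have "(\<Sum>i\<in>vec_support d \<nu>\<^sub>0. \<gamma> i j) = (\<Sum>i=1..d. \<gamma> i j)"
    using transport_plan_off_support[OF assms _ j] by (intro sum.mono_neutral_left) (auto simp: vec_support_def)
  then show "(\<Sum>i\<in>vec_support d \<nu>\<^sub>0. \<gamma> i j) = \<nu>\<^sub>1 j"
    using transport_plansD(3)[OF assms(1) j] by simp
qed

lemma vec_support_props:
  assumes "prob_vector d \<nu>"
  shows "finite (vec_support d \<nu>)" "vec_support d \<nu> \<noteq> {}" "vec_support d \<nu> \<subseteq> {1..d}"
proof -
  show "vec_support d \<nu> \<noteq> {}"
  proof
    assume "vec_support d \<nu> = {}"
    then have "(\<Sum>i=1..d. \<nu> i) \<le> 0"
      by (intro sum_nonpos) (force simp: vec_support_def not_less)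
    then show False
      using assms by (simp add: prob_vector_def)
  qed
qed (auto simp: vec_support_def)

text \<open>The cycle inequality holds in both directions, so
  \<open>\<gamma> i j / gibbs_kernel \<epsilon> i j\<close> has trivial cross ratios. Once
  positivity on the product of the supports is known, this makes it a product of a row factor and a
  column factor.\<close>

lemma minimizer_scaling_form:
  assumes eps: "0 < \<epsilon>"
    and prob: "prob_vector d \<nu>\<^sub>0" "prob_vector d \<nu>\<^sub>1"
    and min: "is_arg_min (regularized_cost d \<epsilon>) (\<lambda>\<gamma>. \<gamma> \<in> transport_plans d \<nu>\<^sub>0 \<nu>\<^sub>1) \<gamma>"
  obtains a b where
    "\<And>i. i \<in> vec_support d \<nu>\<^sub>0 \<Longrightarrow> 0 < a i" "\<And>j. j \<in> vec_support d \<nu>\<^sub>1 \<Longrightarrow> 0 < b j"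
    "\<And>i j. i \<in> vec_support d \<nu>\<^sub>0 \<Longrightarrow> j \<in> vec_support d \<nu>\<^sub>1 \<Longrightarrow> \<gamma> i j = a i * gibbs_kernel \<epsilon> i j * b j"
proof -
  let ?K = "gibbs_kernel \<epsilon>"
  let ?S = "vec_support d \<nu>\<^sub>0" and ?T = "vec_support d \<nu>\<^sub>1"
  note S = vec_support_props[OF prob(1)] and T = vec_support_props[OF prob(2)]
  have plan: "\<gamma> \<in> transport_plans d \<nu>\<^sub>0 \<nu>\<^sub>1"
    using min by (simp add: is_arg_min_def)
  note \<gamma>0 = transport_plansD(1)[OF plan]
  have pos: "0 < \<gamma> i j" if i: "i \<in> ?S" and j: "j \<in> ?T" for i j
  proof -
    have id: "i \<in> {1..d}" "j \<in> {1..d}"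
      using that S(3) T(3) by blast+
    have sums: "(\<Sum>l\<in>?T. \<gamma> i l) > 0" "(\<Sum>k\<in>?S. \<gamma> k j) > 0"
      using transport_plan_sums_support[OF plan prob] id i j by (simp_all add: vec_support_def)
    \<comment> \<open>Some mass sits in row \<open>i\<close> and some in column \<open>j\<close>.
      These two entries make the left side of the cycle inequality positive, which rules out
      \<open>\<gamma> i j = 0\<close>.\<close>
    obtain j' where "j' \<in> ?T" "0 < \<gamma> i j'"
      using sums(1) sum_nonpos[of ?T "\<gamma> i"] by (metis not_le)
    moreover obtain i' where "i' \<in> ?S" "0 < \<gamma> i' j"
      using sums(2) sum_nonpos[of ?S "\<lambda>k. \<gamma> k j"] by (metis not_le)
    ultimately have ij: "j' \<in> ?T" "0 < \<gamma> i j'" "i' \<in> ?S" "0 < \<gamma> i' j"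
      by simp_all
    then have id': "i' \<in> {1..d}" "j' \<in> {1..d}"
      using S(3) T(3) by blast+
    have "0 < \<gamma> i j' * \<gamma> i' j * (?K i j * ?K i' j')"
      using ij gibbs_kernel_pos[of \<epsilon>] by (simp add: mult_pos_pos)
    also have "\<dots> \<le> \<gamma> i j * \<gamma> i' j' * (?K i j' * ?K i' j)"
      by (rule minimizer_cycle_le[OF eps min id(1) id'(1) id(2) id'(2)])
    finally have "\<gamma> i j \<noteq> 0"
      by auto
    then show ?thesis
      using \<gamma>0[OF id] by simp
  qed
  have cyc: "\<gamma> i j' * \<gamma> i' j * (?K i j * ?K i' j') = \<gamma> i j * \<gamma> i' j' * (?K i j' * ?K i' j)"
    if "i \<in> {1..d}" "i' \<in> {1..d}" "j \<in> {1..d}" "j' \<in> {1..d}" for i i' j j'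
    using minimizer_cycle_le[OF eps min that] minimizer_cycle_le[OF eps min that(1,2,4,3)] by simp
  obtain i0 j0 where 0: "i0 \<in> ?S" "j0 \<in> ?T"
    using S T by blast
  \<comment> \<open>The factors are read off from the base row \<open>i0\<close> and the base column
    \<open>j0\<close>, normalized so that \<open>a i0 = 1\<close>.\<close>
  define b where "b j = \<gamma> i0 j / ?K i0 j" for j
  define a where "a i = \<gamma> i j0 / (?K i j0 * b j0)" for i
  show ?thesis
  proof
    show b: "0 < b j" if "j \<in> ?T" for j
      using pos[OF 0(1) that] gibbs_kernel_pos[of \<epsilon>] by (simp add: b_def)
    show "0 < a i" if "i \<in> ?S" for i
      using pos[OF that 0(2)] b[OF 0(2)] gibbs_kernel_pos[of \<epsilon>] by (simp add: a_def)
    fix i j assume ij: "i \<in> ?S" "j \<in> ?T"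
    then have "\<gamma> i j0 * \<gamma> i0 j * (?K i j * ?K i0 j0) = \<gamma> i j * \<gamma> i0 j0 * (?K i j0 * ?K i0 j)"
      using cyc[of i i0 j j0] 0 S T by blast
    then show "\<gamma> i j = a i * ?K i j * b j"
      using pos[OF 0] gibbs_kernel_pos[of \<epsilon> i j0] gibbs_kernel_pos[of \<epsilon> i0 j] gibbs_kernel_pos[of \<epsilon> i0 j0]
      by (simp add: a_def b_def divide_simps mult_ac order_less_imp_not_eq2)
  qed
qed

section \<open>Convergence of the iteration\<close>

lemma kernel_eta_cross:
  assumes K: "\<And>i j. i \<in> {1..d} \<Longrightarrow> j \<in> {1..d} \<Longrightarrow> 0 < K i j"
    and ij: "i \<in> {1..d}" "i' \<in> {1..d}" "j \<in> {1..d}" "j' \<in> {1..d}"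
  shows "K i j * K i' j' \<le> kernel_eta d K * (K i' j * K i j')"
proof -
  let ?R = "{K i j * K i' j' / (K i' j * K i j') | i j i' j'.
    i \<in> {1..d} \<and> j \<in> {1..d} \<and> i' \<in> {1..d} \<and> j' \<in> {1..d}}"
  let ?q = "\<lambda>(i, j, i', j'). K i j * K i' j' / (K i' j * K i j')"
  have "?R \<subseteq> ?q ` ({1..d} \<times> {1..d} \<times> {1..d} \<times> {1..d})"
  proof clarify
    fix i j i' j' assume "i \<in> {1..d}" "j \<in> {1..d}" "i' \<in> {1..d}" "j' \<in> {1..d}"
    then show "K i j * K i' j' / (K i' j * K i j') \<in> ?q ` ({1..d} \<times> {1..d} \<times> {1..d} \<times> {1..d})"
      by (intro rev_image_eqI[of "(i, j, i', j')"]) auto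
  qed
  then have "finite ?R"
    by (rule finite_subset) simp
  then have "K i j * K i' j' / (K i' j * K i j') \<le> kernel_eta d K"
    unfolding kernel_eta_def using ij by (intro Max_ge) auto
  then show ?thesis
    using K ij by (simp add: pos_divide_le_eq)
qed

lemma kernel_eta_ge_1:
  assumes K: "\<And>i j. i \<in> {1..d} \<Longrightarrow> j \<in> {1..d} \<Longrightarrow> 0 < K i j"
    and "1 \<le> d"
  shows "1 \<le> kernel_eta d K"
  using kernel_eta_cross[of d K 1 1 1 1] K[of 1 1] \<open>1 \<le> d\<close> K by simp

section \<open>Positivity and marginals of the iterates\<close>

lemma sinkhorn_pos:
  assumes K: "\<And>i j. i \<in> {1..d} \<Longrightarrow> j \<in> {1..d} \<Longrightarrow> 0 < K i j"
    and prob: "prob_vector d \<nu>\<^sub>0" "prob_vector d \<nu>\<^sub>1"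
  shows "i \<in> vec_support d \<nu>\<^sub>0 \<Longrightarrow> 0 < sinkhorn_u d K \<nu>\<^sub>0 \<nu>\<^sub>1 k i"
    and "j \<in> vec_support d \<nu>\<^sub>1 \<Longrightarrow> 0 < sinkhorn_v d K \<nu>\<^sub>0 \<nu>\<^sub>1 k j"
    and "j \<in> {1..d} \<Longrightarrow> 0 \<le> sinkhorn_v d K \<nu>\<^sub>0 \<nu>\<^sub>1 k j"
proof -
  let ?S = "vec_support d \<nu>\<^sub>0" and ?T = "vec_support d \<nu>\<^sub>1"
  let ?u = "sinkhorn_u d K \<nu>\<^sub>0 \<nu>\<^sub>1" and ?v = "sinkhorn_v d K \<nu>\<^sub>0 \<nu>\<^sub>1"
  note S = vec_support_props[OF prob(1)] and T = vec_support_props[OF prob(2)]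
  have sum_pos': "0 < (\<Sum>l=1..d. c l * x l)"
    if "\<And>l. l \<in> {1..d} \<Longrightarrow> 0 < c l" "\<And>l. l \<in> {1..d} \<Longrightarrow> 0 \<le> x l" "l \<in> {1..d}" "0 < x l"
    for c x :: "nat \<Rightarrow> real" and l
    using that by (intro sum_pos2[of _ l]) (auto intro!: mult_pos_pos mult_nonneg_nonneg simp: less_imp_le)
  \<comment> \<open>All four claims are proved together: the denominators sum over all of
    \<open>{1..d}\<close>, where the terms are nonnegative and an index in the support contributes a
    positive one.\<close>
  have "(\<forall>i\<in>?S. 0 < ?u k i) \<and> (\<forall>i\<in>{1..d}. 0 \<le> ?u k i) \<and> (\<forall>j\<in>?T. 0 < ?v k j) \<and> (\<forall>j\<in>{1..d}. 0 \<le> ?v k j)"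
  proof (induction k)
    case (Suc k)
    obtain i0 j0 where 0: "i0 \<in> ?S" "j0 \<in> ?T"
      using S T by blast
    have "0 < (\<Sum>j=1..d. K i j * ?v k j)" if "i \<in> {1..d}" for i
      by (rule sum_pos'[OF K[OF that] _ subsetD[OF T(3) 0(2)]]) (use Suc 0 in blast)+
    then have u: "\<forall>i\<in>?S. 0 < ?u (Suc k) i" "\<forall>i\<in>{1..d}. 0 \<le> ?u (Suc k) i"
      using prob(1) by (auto simp: vec_support_def prob_vector_def less_imp_le)
    have "0 < (\<Sum>i=1..d. K i j * ?u (Suc k) i)" if "j \<in> {1..d}" for j
      by (rule sum_pos'[OF K[OF _ that] _ subsetD[OF S(3) 0(1)]]) (use u 0 in blast)+
    then have "\<forall>j\<in>?T. 0 < ?v (Suc k) j" "\<forall>j\<in>{1..d}. 0 \<le> ?v (Suc k) j"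
      using prob(2) by (auto simp: vec_support_def prob_vector_def less_imp_le simp del: sinkhorn_u.simps)
    with u show ?case by blast
  qed simp
  then show "i \<in> ?S \<Longrightarrow> 0 < ?u k i" "j \<in> ?T \<Longrightarrow> 0 < ?v k j" "j \<in> {1..d} \<Longrightarrow> 0 \<le> ?v k j"
    by blast+
qed

lemma sinkhorn_off_support:
  assumes prob: "prob_vector d \<nu>\<^sub>0" "prob_vector d \<nu>\<^sub>1"
  shows "i \<in> {1..d} \<Longrightarrow> i \<notin> vec_support d \<nu>\<^sub>0 \<Longrightarrow> sinkhorn_u d K \<nu>\<^sub>0 \<nu>\<^sub>1 (Suc k) i = 0"
    and "j \<in> {1..d} \<Longrightarrow> j \<notin> vec_support d \<nu>\<^sub>1 \<Longrightarrow> sinkhorn_v d K \<nu>\<^sub>0 \<nu>\<^sub>1 (Suc k) j = 0"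
  using prob by (simp_all add: vec_eq_0_off_support)

text \<open>The updates in the product form that \<open>scaling_step_contraction\<close> uses, with
  sums over the supports only. The first equation starts from \<open>v\<close> at
  \<open>Suc k\<close>, since \<open>v\<close> at 0 equals 1 off the support as well.\<close>

lemma sinkhorn_marginals:
  assumes K: "\<And>i j. i \<in> {1..d} \<Longrightarrow> j \<in> {1..d} \<Longrightarrow> 0 < K i j"
    and prob: "prob_vector d \<nu>\<^sub>0" "prob_vector d \<nu>\<^sub>1"
  shows "i \<in> vec_support d \<nu>\<^sub>0 \<Longrightarrow>
      sinkhorn_u d K \<nu>\<^sub>0 \<nu>\<^sub>1 (Suc (Suc k)) i
        * (\<Sum>j\<in>vec_support d \<nu>\<^sub>1. K i j * sinkhorn_v d K \<nu>\<^sub>0 \<nu>\<^sub>1 (Suc k) j) = \<nu>\<^sub>0 i"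
    and "j \<in> vec_support d \<nu>\<^sub>1 \<Longrightarrow>
      sinkhorn_v d K \<nu>\<^sub>0 \<nu>\<^sub>1 (Suc k) j
        * (\<Sum>i\<in>vec_support d \<nu>\<^sub>0. K i j * sinkhorn_u d K \<nu>\<^sub>0 \<nu>\<^sub>1 (Suc k) i) = \<nu>\<^sub>1 j"
proof -
  let ?S = "vec_support d \<nu>\<^sub>0" and ?T = "vec_support d \<nu>\<^sub>1"
  let ?u = "sinkhorn_u d K \<nu>\<^sub>0 \<nu>\<^sub>1" and ?v = "sinkhorn_v d K \<nu>\<^sub>0 \<nu>\<^sub>1"
  note S = vec_support_props[OF prob(1)] and T = vec_support_props[OF prob(2)]
  assume i: "i \<in> ?S"
  have "(\<Sum>j\<in>?T. K i j * ?v (Suc k) j) = (\<Sum>j=1..d. K i j * ?v (Suc k) j)"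
    using T sinkhorn_off_support(2)[OF prob, where k = k] by (intro sum.mono_neutral_left) auto
  moreover have "0 < (\<Sum>j\<in>?T. K i j * ?v (Suc k) j)"
    using i S T K sinkhorn_pos(2)[of d K, OF K prob, where k = "Suc k"] by (intro sum_pos mult_pos_pos) blast+
  ultimately show "?u (Suc (Suc k)) i * (\<Sum>j\<in>?T. K i j * ?v (Suc k) j) = \<nu>\<^sub>0 i"
    by (subst sinkhorn_u.simps) (simp del: sinkhorn_v.simps)
next
  let ?S = "vec_support d \<nu>\<^sub>0" and ?T = "vec_support d \<nu>\<^sub>1"
  let ?u = "sinkhorn_u d K \<nu>\<^sub>0 \<nu>\<^sub>1" and ?v = "sinkhorn_v d K \<nu>\<^sub>0 \<nu>\<^sub>1"
  note S = vec_support_props[OF prob(1)] and T = vec_support_props[OF prob(2)]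
  assume j: "j \<in> ?T"
  have "(\<Sum>i\<in>?S. K i j * ?u (Suc k) i) = (\<Sum>i=1..d. K i j * ?u (Suc k) i)"
    using S sinkhorn_off_support(1)[OF prob, where k = k] by (intro sum.mono_neutral_left) auto
  moreover have "0 < (\<Sum>i\<in>?S. K i j * ?u (Suc k) i)"
    using j S T K sinkhorn_pos(1)[of d K, OF K prob, where k = "Suc k"] by (intro sum_pos mult_pos_pos) blast+
  ultimately show "?v (Suc k) j * (\<Sum>i\<in>?S. K i j * ?u (Suc k) i) = \<nu>\<^sub>1 j"
    by (subst sinkhorn_v.simps) (simp del: sinkhorn_u.simps)
qed

text \<open>The index is shifted because the initial vector \<open>v\<close> is not supported on the support of
  \<open>\<nu>\<^sub>1\<close>.\<close>

lemma sinkhorn_log_osc: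
  assumes K: "\<And>i j. i \<in> {1..d} \<Longrightarrow> j \<in> {1..d} \<Longrightarrow> 0 < K i j"
    and prob: "prob_vector d \<nu>\<^sub>0" "prob_vector d \<nu>\<^sub>1"
    and a: "\<And>i. i \<in> vec_support d \<nu>\<^sub>0 \<Longrightarrow> 0 < a i" and b: "\<And>j. j \<in> vec_support d \<nu>\<^sub>1 \<Longrightarrow> 0 < b j"
    and row: "\<And>i. i \<in> vec_support d \<nu>\<^sub>0 \<Longrightarrow> a i * (\<Sum>j\<in>vec_support d \<nu>\<^sub>1. K i j * b j) = \<nu>\<^sub>0 i"
    and col: "\<And>j. j \<in> vec_support d \<nu>\<^sub>1 \<Longrightarrow> b j * (\<Sum>i\<in>vec_support d \<nu>\<^sub>0. K i j * a i) = \<nu>\<^sub>1 j"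
  obtains D where "\<And>k. osc_le (vec_support d \<nu>\<^sub>1)
    (\<lambda>j. ln (sinkhorn_v d K \<nu>\<^sub>0 \<nu>\<^sub>1 (Suc k) j) - ln (b j)) (contraction_coeff d K ^ (2 * k) * D)"
proof -
  let ?S = "vec_support d \<nu>\<^sub>0" and ?T = "vec_support d \<nu>\<^sub>1"
  let ?u = "sinkhorn_u d K \<nu>\<^sub>0 \<nu>\<^sub>1" and ?v = "sinkhorn_v d K \<nu>\<^sub>0 \<nu>\<^sub>1"
  let ?r = "contraction_coeff d K"
  note S = vec_support_props[OF prob(1)] and T = vec_support_props[OF prob(2)]
  have r: "?r = cross_ratio_coeff (kernel_eta d K)"
    by (simp add: contraction_coeff_def cross_ratio_coeff_def)
  \<comment> \<open>The constant is an oscillation bound for the first update of \<open>v\<close>;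
    finiteness of the support provides it.\<close>
  obtain D where D: "osc_le ?T (\<lambda>j. ln (?v (Suc 0) j) - ln (b j)) D"
    using osc_le_exists[OF T(1)] by blast
  have "osc_le ?T (\<lambda>j. ln (?v (Suc k) j) - ln (b j)) (?r ^ (2 * k) * D)" for k
  proof (induction k)
    case 0
    then show ?case using D by (simp del: sinkhorn_v.simps)
  next
    case (Suc k)
    have u: "osc_le ?S (\<lambda>i. ln (?u (Suc (Suc k)) i) - ln (a i)) (?r * (?r ^ (2 * k) * D))"
      unfolding r
    proof (rule scaling_step_contraction[OF T(1,2), where K = K and v = "?v (Suc k)" and b = b])
      show "K i j * K i' j' \<le> kernel_eta d K * (K i' j * K i j')"
        if "i \<in> ?S" "i' \<in> ?S" "j \<in> ?T" "j' \<in> ?T" for i i' j j'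
        by (rule kernel_eta_cross[of d K, OF K]) (use that S(3) T(3) in blast)+
      show "?u (Suc (Suc k)) i * (\<Sum>j\<in>?T. K i j * ?v (Suc k) j) = a i * (\<Sum>j\<in>?T. K i j * b j)"
        if "i \<in> ?S" for i
        by (simp only: sinkhorn_marginals(1)[of d K, OF K prob that] row[OF that])
      show "0 < K i j" if "i \<in> ?S" "j \<in> ?T" for i j
        using that S T K by blast
    qed (use Suc[unfolded r] a b sinkhorn_pos(1,2)[of d K, OF K prob] in blast)+
    \<comment> \<open>The second half step uses the transposed kernel, which has the same cross
      ratios. Two half steps per iteration produce the exponent \<open>2 * k\<close>.\<close>
    have "osc_le ?T (\<lambda>j. ln (?v (Suc (Suc k)) j) - ln (b j)) (?r * (?r * (?r ^ (2 * k) * D)))"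
      unfolding r
    proof (rule scaling_step_contraction[OF S(1,2), where K = "\<lambda>j i. K i j" and v = "?u (Suc (Suc k))" and b = a])
      show "K j i * K j' i' \<le> kernel_eta d K * (K j i' * K j' i)"
        if "i \<in> ?T" "i' \<in> ?T" "j \<in> ?S" "j' \<in> ?S" for i i' j j'
        using kernel_eta_cross[of d K j j' i i', OF K] that S T by (simp add: subset_iff mult_ac)
      show "?v (Suc (Suc k)) j * (\<Sum>i\<in>?S. K i j * ?u (Suc (Suc k)) i) = b j * (\<Sum>i\<in>?S. K i j * a i)"
        if "j \<in> ?T" for j
        by (simp only: sinkhorn_marginals(2)[of d K, OF K prob that] col[OF that])
      show "0 < K j i" if "i \<in> ?T" "j \<in> ?S" for i j
        using that S T K by blast
    qed (use u[unfolded r] a b sinkhorn_pos(1,2)[of d K, OF K prob] in blast)+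
    moreover have "?r * (?r * (?r ^ (2 * k) * D)) = ?r ^ (2 * Suc k) * D"
      by simp
    ultimately show ?case
      by metis
  qed
  then show ?thesis ..
qed

text \<open>The row factor \<open>c\<close> cancels in the quotient. For plans of scaling form, the
  function therefore depends on the column scaling alone.\<close>

lemma assoc_fun_product_row:
  assumes T: "T \<subseteq> {1..d}" and c: "c \<noteq> 0"
    and on: "\<And>j. j \<in> T \<Longrightarrow> \<gamma> i j = c * w j"
    and off: "\<And>j. j \<in> {1..d} \<Longrightarrow> j \<notin> T \<Longrightarrow> \<gamma> i j = 0"
  shows "assoc_fun d \<gamma> i = (\<Sum>j\<in>T. w j * real j) / (\<Sum>j\<in>T. w j) - real i"
proof -
  have "(\<Sum>j=1..d. \<gamma> i j * x j) = (\<Sum>j\<in>T. \<gamma> i j * x j)" for x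
    using T off by (intro sum.mono_neutral_right) auto
  then have sum: "(\<Sum>j=1..d. \<gamma> i j * x j) = c * (\<Sum>j\<in>T. w j * x j)" for x
    using on by (simp add: sum_distrib_left mult.assoc)
  show ?thesis
    unfolding assoc_fun_def using sum[of real] sum[of "\<lambda>_. 1"] c by simp
qed

text \<open>Both functions are means of the position \<open>j\<close>, shifted by \<open>i\<close>,
  with weights \<open>K i j * v j\<close> and \<open>K i j * b j\<close>. The factor
  \<open>K i j\<close> drops out of the log-ratio, so the oscillation bound for \<open>v\<close>
  against \<open>b\<close> gives one constant for all rows.\<close>

lemma assoc_fun_sinkhorn_error:
  assumes d: "d \<ge> 1" and prob: "prob_vector d \<nu>\<^sub>0" "prob_vector d \<nu>\<^sub>1" and eps: "\<epsilon> > 0"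
    and min: "is_arg_min (regularized_cost d \<epsilon>) (\<lambda>\<gamma>. \<gamma> \<in> transport_plans d \<nu>\<^sub>0 \<nu>\<^sub>1) \<gamma>"
  obtains C where "\<And>k i. i \<in> vec_support d \<nu>\<^sub>0 \<Longrightarrow>
    \<bar>assoc_fun d (sinkhorn_plan_odd d (gibbs_kernel \<epsilon>) \<nu>\<^sub>0 \<nu>\<^sub>1 (Suc k)) i - assoc_fun d \<gamma> i\<bar>
      \<le> C * contraction_coeff d (gibbs_kernel \<epsilon>) ^ (2 * k)"
proof -
  let ?K = "gibbs_kernel \<epsilon>"
  let ?S = "vec_support d \<nu>\<^sub>0" and ?T = "vec_support d \<nu>\<^sub>1"
  let ?v = "sinkhorn_v d ?K \<nu>\<^sub>0 \<nu>\<^sub>1" and ?u = "sinkhorn_u d ?K \<nu>\<^sub>0 \<nu>\<^sub>1"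
  note S = vec_support_props[OF prob(1)] and T = vec_support_props[OF prob(2)]
  have plan: "\<gamma> \<in> transport_plans d \<nu>\<^sub>0 \<nu>\<^sub>1"
    using min by (simp add: is_arg_min_def)
  obtain a b where a: "\<And>i. i \<in> ?S \<Longrightarrow> 0 < a i" and b: "\<And>j. j \<in> ?T \<Longrightarrow> 0 < b j"
    and ab: "\<And>i j. i \<in> ?S \<Longrightarrow> j \<in> ?T \<Longrightarrow> \<gamma> i j = a i * ?K i j * b j"
    using minimizer_scaling_form[OF eps prob min] by blast
  \<comment> \<open>The marginal constraints of \<open>\<gamma>\<close> become the fixed point
    equations of Sinkhorn's iteration for \<open>a\<close> and \<open>b\<close>.\<close>
  have row: "a i * (\<Sum>j\<in>?T. ?K i j * b j) = \<nu>\<^sub>0 i" if "i \<in> ?S" for i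
  proof -
    have "a i * (\<Sum>j\<in>?T. ?K i j * b j) = (\<Sum>j\<in>?T. \<gamma> i j)"
      using ab[OF that] by (simp add: sum_distrib_left mult.assoc)
    then show ?thesis
      using transport_plan_sums_support(1)[OF plan prob] that S by (metis subsetD)
  qed
  have col: "b j * (\<Sum>i\<in>?S. ?K i j * a i) = \<nu>\<^sub>1 j" if "j \<in> ?T" for j
  proof -
    have "b j * (\<Sum>i\<in>?S. ?K i j * a i) = (\<Sum>i\<in>?S. \<gamma> i j)"
      using ab[OF _ that] by (simp add: sum_distrib_left mult_ac)
    then show ?thesis
      using transport_plan_sums_support(2)[OF plan prob] that T by (metis subsetD)
  qed
  obtain D where D: "\<And>k. osc_le ?T (\<lambda>j. ln (?v (Suc k) j) - ln (b j)) (contraction_coeff d ?K ^ (2 * k) * D)"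
    using sinkhorn_log_osc[of d ?K, OF gibbs_kernel_pos prob a b row col] by blast
  have "\<bar>assoc_fun d (sinkhorn_plan_odd d ?K \<nu>\<^sub>0 \<nu>\<^sub>1 (Suc k)) i - assoc_fun d \<gamma> i\<bar>
      \<le> (D / 2 * real d) * contraction_coeff d ?K ^ (2 * k)" if i: "i \<in> ?S" for k i
  proof -
    have u: "0 < ?u (Suc (Suc k)) i"
      by (rule sinkhorn_pos(1)[of d ?K, OF gibbs_kernel_pos prob i])
    have v: "0 < ?v (Suc k) j" if "j \<in> ?T" for j
      by (rule sinkhorn_pos(2)[of d ?K, OF gibbs_kernel_pos prob that])
    have v0: "?v (Suc k) j = 0" if "j \<in> {1..d}" "j \<notin> ?T" for j
      by (rule sinkhorn_off_support(2)[OF prob that])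
    have f1: "assoc_fun d (sinkhorn_plan_odd d ?K \<nu>\<^sub>0 \<nu>\<^sub>1 (Suc k)) i
        = (\<Sum>j\<in>?T. ?K i j * ?v (Suc k) j * real j) / (\<Sum>j\<in>?T. ?K i j * ?v (Suc k) j) - real i"
      by (rule assoc_fun_product_row[OF T(3), where c = "?u (Suc (Suc k)) i"])
        (use u v0 in \<open>simp_all add: sinkhorn_plan_odd_def mult.assoc del: sinkhorn_u.simps sinkhorn_v.simps\<close>)
    have f2: "assoc_fun d \<gamma> i = (\<Sum>j\<in>?T. ?K i j * b j * real j) / (\<Sum>j\<in>?T. ?K i j * b j) - real i"
      by (rule assoc_fun_product_row[OF T(3), where c = "a i"])
        (use a[OF i] ab[OF i] i S transport_plan_off_support[OF plan prob] in \<open>auto simp: mult.assoc\<close>)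
    have log: "osc_le ?T (\<lambda>j. ln (?K i j * ?v (Suc k) j) - ln (?K i j * b j)) (contraction_coeff d ?K ^ (2 * k) * D)"
      unfolding osc_le_def
    proof (intro ballI)
      fix j l assume jl: "j \<in> ?T" "l \<in> ?T"
      have "ln (?K i m * ?v (Suc k) m) - ln (?K i m * b m) = ln (?v (Suc k) m) - ln (b m)" if "m \<in> ?T" for m
        using v[OF that] b[OF that] gibbs_kernel_pos[of \<epsilon> i m]
        by (simp add: ln_mult order_less_imp_not_eq2 del: sinkhorn_v.simps)
      then show "ln (?K i j * ?v (Suc k) j) - ln (?K i j * b j) - (ln (?K i l * ?v (Suc k) l) - ln (?K i l * b l))
        \<le> contraction_coeff d ?K ^ (2 * k) * D"
        using osc_leD[OF D jl, of k] jl by metis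
    qed
    have "osc_le ?T real (real d)"
      using T(3) by (force simp: osc_le_def)
    then have "\<bar>(\<Sum>j\<in>?T. ?K i j * ?v (Suc k) j * real j) / (\<Sum>j\<in>?T. ?K i j * ?v (Suc k) j)
        - (\<Sum>j\<in>?T. ?K i j * b j * real j) / (\<Sum>j\<in>?T. ?K i j * b j)\<bar>
      \<le> contraction_coeff d ?K ^ (2 * k) * D / 2 * real d"
      using v b gibbs_kernel_pos by (intro abs_mean_diff_le_log_osc[OF T(1,2) _ _ log] mult_pos_pos)
    then show ?thesis
      unfolding f1 f2 by (simp add: mult_ac del: sinkhorn_v.simps)
  qed
  then show ?thesis ..
qed

theorem theorem5p2:
  fixes d :: nat and \<nu>\<^sub>0 \<nu>\<^sub>1 :: "nat \<Rightarrow> real" and \<epsilon> :: real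
    and \<gamma>\<^sub>\<epsilon> :: "nat \<Rightarrow> nat \<Rightarrow> real"
  assumes "d \<ge> 1"
    and "prob_vector d \<nu>\<^sub>0"
    and "prob_vector d \<nu>\<^sub>1"
    and "\<epsilon> > 0"
    and "is_arg_min (regularized_cost d \<epsilon>) (\<lambda>\<gamma>. \<gamma> \<in> transport_plans d \<nu>\<^sub>0 \<nu>\<^sub>1) \<gamma>\<^sub>\<epsilon>"
  shows "uniform_limit (vec_support d \<nu>\<^sub>0)
           (\<lambda>k. assoc_fun d (sinkhorn_plan_odd d (gibbs_kernel \<epsilon>) \<nu>\<^sub>0 \<nu>\<^sub>1 k))
           (assoc_fun d \<gamma>\<^sub>\<epsilon>) sequentially
       \<and> (\<lambda>k. sup_norm_on (vec_support d \<nu>\<^sub>0)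
                (\<lambda>i. assoc_fun d (sinkhorn_plan_odd d (gibbs_kernel \<epsilon>) \<nu>\<^sub>0 \<nu>\<^sub>1 k) i
                      - assoc_fun d \<gamma>\<^sub>\<epsilon> i))
           \<in> O(\<lambda>k. contraction_coeff d (gibbs_kernel \<epsilon>) ^ (2 * k))"
proof -
  let ?S = "vec_support d \<nu>\<^sub>0"
  let ?f = "\<lambda>k. assoc_fun d (sinkhorn_plan_odd d (gibbs_kernel \<epsilon>) \<nu>\<^sub>0 \<nu>\<^sub>1 k)"
  let ?g = "assoc_fun d \<gamma>\<^sub>\<epsilon>"
  define r where "r = contraction_coeff d (gibbs_kernel \<epsilon>)"
  note S = vec_support_props[OF assms(2)]
  have "r = cross_ratio_coeff (kernel_eta d (gibbs_kernel \<epsilon>))"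
    by (simp add: r_def contraction_coeff_def cross_ratio_coeff_def)
  moreover have "1 \<le> kernel_eta d (gibbs_kernel \<epsilon>)"
    using kernel_eta_ge_1[of d "gibbs_kernel \<epsilon>", OF gibbs_kernel_pos assms(1)] .
  ultimately have r: "0 \<le> r" "r < 1"
    by (simp_all add: cross_ratio_coeff_nonneg cross_ratio_coeff_less_1)
  obtain C where C: "\<And>k i. i \<in> ?S \<Longrightarrow> \<bar>?f (Suc k) i - ?g i\<bar> \<le> C * r ^ (2 * k)"
    unfolding r_def using assoc_fun_sinkhorn_error[OF assms] by blast
  have "(\<lambda>k. C * r ^ (2 * k)) \<longlonglongrightarrow> 0"
    using r by (simp add: power_mult power_less_one_iff tendsto_mult_right_zero LIMSEQ_power_zero abs_square_less_1)
  have "uniform_limit ?S (\<lambda>k. ?f (Suc k)) ?g sequentially"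
  proof (rule uniform_limitI)
    fix e :: real assume "0 < e"
    with \<open>(\<lambda>k. C * r ^ (2 * k)) \<longlonglongrightarrow> 0\<close> have "\<forall>\<^sub>F k in sequentially. C * r ^ (2 * k) < e"
      by (rule order_tendstoD)
    then show "\<forall>\<^sub>F k in sequentially. \<forall>i\<in>?S. dist (?f (Suc k) i) (?g i) < e"
      by eventually_elim (auto simp: dist_real_def intro: le_less_trans[OF C])
  qed
  \<comment> \<open>The error bound starts at \<open>Suc k\<close>; dropping the first plan does not
    affect the limit.\<close>
  then have "uniform_limit ?S ?f ?g sequentially"
    by (rule filterlim_sequentially_Suc[THEN iffD1])
  moreover have "(\<lambda>k. sup_norm_on ?S (\<lambda>i. ?f k i - ?g i)) \<in> O(\<lambda>k. r ^ (2 * k))"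
  proof (rule bigoI)
    \<comment> \<open>For \<open>r = 0\<close> the constant \<open>C / r\<^sup>2\<close> is 0, and the error does vanish once \<open>k \<ge> 2\<close>.\<close>
    show "\<forall>\<^sub>F k in sequentially. norm (sup_norm_on ?S (\<lambda>i. ?f k i - ?g i)) \<le> C / r\<^sup>2 * norm (r ^ (2 * k))"
      using eventually_ge_at_top[of 2]
    proof eventually_elim
      case (elim k)
      define m where "m = k - 1"
      have k: "k = Suc m" "m \<noteq> 0"
        using elim by (simp_all add: m_def)
      \<comment> \<open>A point of the support shows that the supremum is nonnegative, so its norm
        is the supremum itself.\<close>
      obtain i0 where i0: "i0 \<in> ?S"
        using S by blast
      have "0 \<le> \<bar>?f k i0 - ?g i0\<bar>"
        by simp
      also have "\<dots> \<le> sup_norm_on ?S (\<lambda>i. ?f k i - ?g i)"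
        unfolding sup_norm_on_def using i0 S by (intro cSUP_upper) auto
      finally have "norm (sup_norm_on ?S (\<lambda>i. ?f k i - ?g i)) = sup_norm_on ?S (\<lambda>i. ?f k i - ?g i)"
        by simp
      also have "\<dots> \<le> C * r ^ (2 * m)"
        unfolding sup_norm_on_def k using S C by (intro cSUP_least) auto
      also have "\<dots> = C / r\<^sup>2 * norm (r ^ (2 * k))"
        using r k by (cases "r = 0") (simp_all add: power2_eq_square)
      finally show ?case .
    qed
  qed
  ultimately show ?thesis
    unfolding r_def by blast
qed

end
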